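(* Let $S_1$ be an $r_2$-net regular signed graph with $n_1$ vertices and net Laplacian eigenvalues (with multiplicity) $v_1(S_1),\dots,v_{n_1}(S_1)$, and let $S_2$ be any signed graph with $n_2$ vertices and net Laplacian eigenvalues (with multiplicity) $v_1(S_2),\dots,v_{n_2}(S_2)$, where $v_k(S_2)=0$ for a fixed index $k$, $1\le k\le n_2$. Then the net Laplacian spectrum (as a multiset) of $S_1\star_s S_2$ consists of: (i) the eigenvalue $v_j(S_2)+r_2$ with multiplicity $n_1$, for every $j\in\{1,\dots,n_2\}$ with $j\neq k$; (ii) the two eigenvalues, each counted once, $$\frac{v_i(S_1)+(n_2+1)r_2\pm\sqrt{\left(v_i(S_1)+(n_2+1)r_2\right)^2-4v_i(S_1)\left((2n_2+1)r_2-n_2v_i(S_1)\right)}}{2}$$ for each $i=1,\dots,n_1$.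
   Context: A signed graph $S=(G,\sigma)$ is a finite simple graph $G$ with a sign function $\sigma:E_G\to\{-1,1\}$. Its adjacency matrix $A_S$ has $(i,j)$ entry $\sigma(v_iv_j)$ if $v_i\sim v_j$ and $0$ otherwise. The net-degree of a vertex is the number of positive edges minus the number of negative edges incident with it; $S$ is $r$-net regular if every vertex has net-degree $r$. $D^{\pm}_S$ is the diagonal matrix of net-degrees, and the net Laplacian matrix is $N_S=D^{\pm}_S-A_S$; net Laplacian eigenvalues/spectrum are those of $N_S$. The s-neighbourhood corona $S_1\star_s S_2$ of signed graphs $S_1=(G_1,\sigma_1)$ (vertices $v_1,\dots,v_{n_1}$) and $S_2$ (with $n_2$ vertices) is the signed graph on $n_1(n_2+1)$ vertices obtained by taking one copy of $S_1$ and $n_1$ disjoint copies of $S_2$, and, for each $i$ and each neighbour $v_h$ of $v_i$ in $S_1$, joining $v_h$ to every vertex of the $i$th copy of $S_2$ by an edge of sign $\sigma_1(v_hv_i)$. *)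

theory Defs
  imports "Jordan_Normal_Form.Char_Poly" "HOL-Library.Multiset" Complex_Main
begin

record 'v sgraph =
  verts :: "'v set"
  edges :: "'v set set"
  edge_sign :: "'v set \<Rightarrow> int"

text \<open>The sign function matters only on edges; its values elsewhere are junk and are never
  consulted below.\<close>

locale signed_graph =
  fixes S :: "'v sgraph"
  assumes finite_verts: "finite (verts S)"
    and simple_edges: "edges S \<subseteq> {{u, v} | u v. u \<in> verts S \<and> v \<in> verts S \<and> u \<noteq> v}"
    and sign_values: "\<And>e. e \<in> edges S \<Longrightarrow> edge_sign S e \<in> {-1, 1}"

definition net_degree :: "'v sgraph \<Rightarrow> 'v \<Rightarrow> int" where
  "net_degree S v =
     int (card {e \<in> edges S. v \<in> e \<and> edge_sign S e = 1})
     - int (card {e \<in> edges S. v \<in> e \<and> edge_sign S e = -1})"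

definition net_regular :: "'v sgraph \<Rightarrow> int \<Rightarrow> bool" where
  "net_regular S r \<longleftrightarrow> (\<forall>v \<in> verts S. net_degree S v = r)"

text \<open>Matrices are taken with respect to an enumeration \<open>vs\<close> of the vertices, with row and
  column indices starting at 0.\<close>

definition enumerates_verts :: "'v list \<Rightarrow> 'v sgraph \<Rightarrow> bool" where
  "enumerates_verts vs S \<longleftrightarrow> distinct vs \<and> set vs = verts S"

definition adjacency_matrix :: "'v sgraph \<Rightarrow> 'v list \<Rightarrow> real mat" where
  "adjacency_matrix S vs = mat (length vs) (length vs)
     (\<lambda>(i, j). if {vs ! i, vs ! j} \<in> edges S
               then real_of_int (edge_sign S {vs ! i, vs ! j}) else 0)"

definition net_degree_matrix :: "'v sgraph \<Rightarrow> 'v list \<Rightarrow> real mat" where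
  "net_degree_matrix S vs = mat (length vs) (length vs)
     (\<lambda>(i, j). if i = j then real_of_int (net_degree S (vs ! i)) else 0)"

definition net_laplacian :: "'v sgraph \<Rightarrow> 'v list \<Rightarrow> real mat" where
  "net_laplacian S vs = net_degree_matrix S vs - adjacency_matrix S vs"

text \<open>The real eigenvalues of a matrix, each repeated according to its algebraic multiplicity.
  Net Laplacian matrices are real symmetric, so for them these are all the eigenvalues (with
  algebraic and geometric multiplicities agreeing).\<close>

definition spectrum_mset :: "real mat \<Rightarrow> real multiset" where
  "spectrum_mset A = proots (char_poly A)"

text \<open>In the s-neighbourhood corona, \<open>Inl v\<close> is the vertex \<open>v\<close> of the copy of \<open>S1\<close>, and
  \<open>Inr (v, w)\<close> is the vertex \<open>w\<close> of the copy of \<open>S2\<close> belonging to \<open>v\<close>. An edge containing a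
  vertex \<open>Inl h\<close> is either an edge of the copy of \<open>S1\<close>, or it is \<open>{Inl h, Inr (v, w)}\<close> with
  \<open>{h, v}\<close> an edge of \<open>S1\<close>; in both cases projecting its endpoints to \<open>S1\<close> gives the edge of
  \<open>S1\<close> from which it inherits its sign.\<close>

definition s_nbhd_corona ::
    "'a sgraph \<Rightarrow> 'b sgraph \<Rightarrow> ('a + 'a \<times> 'b) sgraph" (infixl "\<star>\<^sub>s" 70) where
  "S1 \<star>\<^sub>s S2 = \<lparr>
     verts = Inl ` verts S1 \<union> Inr ` (verts S1 \<times> verts S2),
     edges = {{Inl u, Inl v} | u v. {u, v} \<in> edges S1}
           \<union> {{Inr (v, w), Inr (v, x)} | v w x. v \<in> verts S1 \<and> {w, x} \<in> edges S2}
           \<union> {{Inl h, Inr (v, w)} | h v w. {h, v} \<in> edges S1 \<and> w \<in> verts S2},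
     edge_sign = (\<lambda>e. if e \<inter> range Inl \<noteq> {}
                       then edge_sign S1 (case_sum id fst ` e)
                       else edge_sign S2 ((snd \<circ> projr) ` e)) \<rparr>"

lemma edge_sign_s_nbhd_corona [simp]:
  "edge_sign (S1 \<star>\<^sub>s S2) {Inl u, Inl v} = edge_sign S1 {u, v}"
  "edge_sign (S1 \<star>\<^sub>s S2) {Inr (v, w), Inr (v, x)} = edge_sign S2 {w, x}"
  "edge_sign (S1 \<star>\<^sub>s S2) {Inl h, Inr (v, w)} = edge_sign S1 {h, v}"
  by (auto simp: s_nbhd_corona_def)

lemma signed_graph_s_nbhd_corona:
  assumes "signed_graph S1" and "signed_graph S2"
  shows "signed_graph (S1 \<star>\<^sub>s S2)"
proof -
  interpret A: signed_graph S1 by fact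
  interpret B: signed_graph S2 by fact
  have E1: "u \<in> verts S1 \<and> v \<in> verts S1 \<and> u \<noteq> v" if "{u, v} \<in> edges S1" for u v
    using A.simple_edges that by (auto simp: doubleton_eq_iff subset_iff)
  have E2: "u \<in> verts S2 \<and> v \<in> verts S2 \<and> u \<noteq> v" if "{u, v} \<in> edges S2" for u v
    using B.simple_edges that by (auto simp: doubleton_eq_iff subset_iff)
  have cases: "P e" if "e \<in> edges (S1 \<star>\<^sub>s S2)"
    "\<And>u v. {u, v} \<in> edges S1 \<Longrightarrow> P {Inl u, Inl v}"
    "\<And>v w x. v \<in> verts S1 \<Longrightarrow> {w, x} \<in> edges S2 \<Longrightarrow> P {Inr (v, w), Inr (v, x)}"
    "\<And>h v w. {h, v} \<in> edges S1 \<Longrightarrow> w \<in> verts S2 \<Longrightarrow> P {Inl h, Inr (v, w)}" for P e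
    using that by (auto simp: s_nbhd_corona_def)
  show ?thesis
  proof
    show "finite (verts (S1 \<star>\<^sub>s S2))"
      by (simp add: s_nbhd_corona_def A.finite_verts B.finite_verts)
    show "edges (S1 \<star>\<^sub>s S2) \<subseteq> {{u, v} | u v.
        u \<in> verts (S1 \<star>\<^sub>s S2) \<and> v \<in> verts (S1 \<star>\<^sub>s S2) \<and> u \<noteq> v}"
    proof
      fix e assume "e \<in> edges (S1 \<star>\<^sub>s S2)"
      then have "\<exists>u v. e = {u, v} \<and> u \<in> verts (S1 \<star>\<^sub>s S2) \<and> v \<in> verts (S1 \<star>\<^sub>s S2) \<and> u \<noteq> v"
      proof (rule cases)
        fix u v assume "{u, v} \<in> edges S1"
        from E1[OF this] show "\<exists>u' v'. {Inl u, Inl v} = {u', v'}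
            \<and> u' \<in> verts (S1 \<star>\<^sub>s S2) \<and> v' \<in> verts (S1 \<star>\<^sub>s S2) \<and> u' \<noteq> v'"
          by (intro exI[of _ "Inl u"] exI[of _ "Inl v"]) (auto simp: s_nbhd_corona_def)
      next
        fix v w x assume "v \<in> verts S1" "{w, x} \<in> edges S2"
        with E2[OF this(2)] show "\<exists>u' v'. {Inr (v, w), Inr (v, x)} = {u', v'}
            \<and> u' \<in> verts (S1 \<star>\<^sub>s S2) \<and> v' \<in> verts (S1 \<star>\<^sub>s S2) \<and> u' \<noteq> v'"
          by (intro exI[of _ "Inr (v, w)"] exI[of _ "Inr (v, x)"]) (auto simp: s_nbhd_corona_def)
      next
        fix h v w assume "{h, v} \<in> edges S1" "w \<in> verts S2"
        with E1[OF this(1)] show "\<exists>u' v'. {Inl h, Inr (v, w)} = {u', v'}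
            \<and> u' \<in> verts (S1 \<star>\<^sub>s S2) \<and> v' \<in> verts (S1 \<star>\<^sub>s S2) \<and> u' \<noteq> v'"
          by (intro exI[of _ "Inl h"] exI[of _ "Inr (v, w)"]) (auto simp: s_nbhd_corona_def)
      qed
      then show "e \<in> {{u, v} | u v.
          u \<in> verts (S1 \<star>\<^sub>s S2) \<and> v \<in> verts (S1 \<star>\<^sub>s S2) \<and> u \<noteq> v}" by blast
    qed
    show "edge_sign (S1 \<star>\<^sub>s S2) e \<in> {-1, 1}" if "e \<in> edges (S1 \<star>\<^sub>s S2)" for e
      using that by (rule cases) (simp_all only: edge_sign_s_nbhd_corona A.sign_values B.sign_values)
  qed
qed

end

theory Submission
  imports Defs "Jordan_Normal_Form.Schur_Decomposition"
begin

text \<open>Since the first graph is \<open>r\<close>-net regular, its adjacency matrix is \<open>r I - N\<close> with \<open>N\<close> its net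
  Laplacian, and the net Laplacian of the corona takes the form \<open>I \<otimes> B + N \<otimes> C\<close>, where \<open>B\<close> and \<open>C\<close>
  have order \<open>n\<^sub>2 + 1\<close>. Triangularizing \<open>N\<close> turns its characteristic polynomial into the product
  over the eigenvalues \<open>e\<close> of \<open>N\<close> of those of \<open>B + e C\<close>. The latter is the matrix \<open>N\<^sub>2 + r I\<close> bordered
  by constant vectors. As all row sums of \<open>N\<^sub>2 + r I\<close> equal \<open>r\<close>, a single column operation splits off
  a quadratic factor, and the remaining factor is the characteristic polynomial of \<open>N\<^sub>2 + r I\<close> with
  one root \<open>r\<close> (coming from the eigenvalue \<open>0\<close> of \<open>N\<^sub>2\<close>) removed.\<close>

subsection \<open>Matrices indexed by lists\<close>

text \<open>Labelling rows by list entries of any type lets Kronecker products be indexed by pairs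
  and vertices by themselves, without arithmetic on positions.\<close>

definition idx_mat :: "('i \<Rightarrow> 'i \<Rightarrow> 'c) \<Rightarrow> 'i list \<Rightarrow> 'c mat" where
  "idx_mat f xs = mat (length xs) (length xs) (\<lambda>(i, j). f (xs ! i) (xs ! j))"

lemma idx_mat_carrier [simp, intro]: "idx_mat f xs \<in> carrier_mat (length xs) (length xs)"
  by (simp add: idx_mat_def)

lemma idx_mat_cong:
  assumes "\<And>x y. x \<in> set xs \<Longrightarrow> y \<in> set xs \<Longrightarrow> f x y = g x y"
  shows "idx_mat f xs = idx_mat g xs"
  using assms by (auto simp: idx_mat_def intro!: eq_matI)

lemma idx_mat_map: "idx_mat f (map h xs) = idx_mat (\<lambda>x y. f (h x) (h y)) xs"
  by (auto simp: idx_mat_def intro!: eq_matI)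

lemma sum_distinct_nth:
  assumes "distinct xs"
  shows "(\<Sum>i = 0..<length xs. f (xs ! i)) = sum f (set xs)"
  using assms by (simp add: sum.distinct_set_conv_list sum_list_sum_nth)

text \<open>The functions \<open>p\<close> and \<open>q\<close> are the entries of the transition
  matrices. Lists of equal length make these square, so a right inverse is already a two-sided one.
  Relabelling rows and conjugating by \<open>P \<otimes> I\<close> are both instances.\<close>

lemma similar_idx_mat:
  fixes f :: "'i \<Rightarrow> 'i \<Rightarrow> 'c::field" and g :: "'j \<Rightarrow> 'j \<Rightarrow> 'c"
  assumes xs: "distinct xs" and ys: "distinct ys" and len: "length xs = length ys"
    and pq: "\<And>x x'. x \<in> set xs \<Longrightarrow> x' \<in> set xs \<Longrightarrow>
      (\<Sum>y\<in>set ys. p x y * q y x') = (if x = x' then 1 else 0)"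
    and fg: "\<And>x x'. x \<in> set xs \<Longrightarrow> x' \<in> set xs \<Longrightarrow>
      f x x' = (\<Sum>y'\<in>set ys. (\<Sum>y\<in>set ys. p x y * g y y') * q y' x')"
  shows "similar_mat (idx_mat f xs) (idx_mat g ys)"
proof -
  define n where "n = length ys"
  define P where "P = mat n n (\<lambda>(i, j). p (xs ! i) (ys ! j))"
  define Q where "Q = mat n n (\<lambda>(i, j). q (ys ! i) (xs ! j))"
  have P: "P \<in> carrier_mat n n" and Q: "Q \<in> carrier_mat n n" by (auto simp: P_def Q_def)
  have G: "idx_mat g ys \<in> carrier_mat n n" by (simp add: n_def)
  have F: "idx_mat f xs \<in> carrier_mat n n" by (simp add: n_def flip: len)
  have PQ: "P * Q = 1\<^sub>m n"
  proof (rule eq_matI)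
    fix i j assume ij: "i < dim_row (1\<^sub>m n :: 'c mat)" "j < dim_col (1\<^sub>m n :: 'c mat)"
    then have "(P * Q) $$ (i, j) = (\<Sum>k = 0..<length ys. p (xs ! i) (ys ! k) * q (ys ! k) (xs ! j))"
      by (simp add: P_def Q_def scalar_prod_def n_def)
    also have "\<dots> = (if xs ! i = xs ! j then 1 else 0)"
      using ij by (subst sum_distinct_nth[OF ys]) (simp add: pq n_def len)
    also have "\<dots> = 1\<^sub>m n $$ (i, j)"
      using ij by (simp add: nth_eq_iff_index_eq[OF xs] len n_def)
    finally show "(P * Q) $$ (i, j) = 1\<^sub>m n $$ (i, j)" .
  qed (auto simp: P_def Q_def)
  have QP: "Q * P = 1\<^sub>m n" by (rule mat_mult_left_right_inverse[OF P Q PQ])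
  have "idx_mat f xs = P * idx_mat g ys * Q"
  proof (rule eq_matI)
    fix i j assume "i < dim_row (P * idx_mat g ys * Q)" "j < dim_col (P * idx_mat g ys * Q)"
    then have ij: "i < n" "j < n" by (auto simp: P_def Q_def)
    have "(P * idx_mat g ys * Q) $$ (i, j) = (\<Sum>k' = 0..<length ys.
        (\<Sum>k = 0..<length ys. p (xs ! i) (ys ! k) * g (ys ! k) (ys ! k')) * q (ys ! k') (xs ! j))"
      using ij by (simp add: P_def Q_def scalar_prod_def n_def idx_mat_def)
    also have "\<dots> = f (xs ! i) (xs ! j)"
      using ij sum_distinct_nth[OF ys, of "\<lambda>y'. (\<Sum>y\<in>set ys. p (xs ! i) y * g y y') * q y' (xs ! j)"]
        sum_distinct_nth[OF ys, of "\<lambda>y. p (xs ! i) y * g y _"]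
      by (simp add: fg n_def len)
    finally show "idx_mat f xs $$ (i, j) = (P * idx_mat g ys * Q) $$ (i, j)"
      using ij by (simp add: idx_mat_def n_def len)
  qed (use F G P Q in auto)
  then show ?thesis
    using F G P Q PQ QP by (intro similar_matI[of _ _ P Q n]) auto
qed

text \<open>The transition matrix is the permutation matrix of \<open>h\<close>. Hence a spectrum
  does not depend on how the vertices are listed.\<close>

lemma similar_idx_mat_reindex:
  fixes f :: "'i \<Rightarrow> 'i \<Rightarrow> 'c::field"
  assumes "distinct xs" and "distinct ys" and h: "bij_betw h (set ys) (set xs)"
  shows "similar_mat (idx_mat f xs) (idx_mat (\<lambda>x y. f (h x) (h y)) ys)"
proof -
  have inj: "inj_on h (set ys)" and im: "h ` set ys = set xs"
    using h by (auto simp: bij_betw_def)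
  have one: "(\<Sum>z\<in>set xs. (if x = z then F z else 0)) = F x" if "x \<in> set xs" for x and F :: "'i \<Rightarrow> 'c"
    using that by simp
  have sum_h: "(\<Sum>y\<in>set ys. F (h y)) = sum F (set xs)" for F :: "'i \<Rightarrow> 'c"
    using sum.reindex[OF inj, of F] im by simp
  show ?thesis
  proof (rule similar_idx_mat[where p = "\<lambda>x y. if x = h y then 1 else 0"
        and q = "\<lambda>y x. if x = h y then 1 else 0"])
    show "length xs = length ys"
      using bij_betw_same_card[OF h] assms by (simp add: distinct_card)
  next
    fix x x' assume x: "x \<in> set xs" "x' \<in> set xs"
    show "(\<Sum>y\<in>set ys. (if x = h y then 1 else 0) * (if x' = h y then 1 else 0))
        = (if x = x' then 1 else (0::'c))"
      using sum_h[of "\<lambda>z. (if x = z then 1 else 0) * (if x' = z then 1 else 0)"] x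
      by (simp add: if_distrib[of "\<lambda>c. c * _"] cong: if_cong)
    have "(\<Sum>y'\<in>set ys. (\<Sum>y\<in>set ys. (if x = h y then 1 else 0) * f (h y) (h y'))
          * (if x' = h y' then 1 else 0))
        = (\<Sum>z'\<in>set xs. (\<Sum>z\<in>set xs. (if x = z then 1 else 0) * f z z')
          * (if x' = z' then 1 else 0))"
      by (subst sum_h[symmetric], subst sum_h[symmetric]) simp
    also have "\<dots> = f x x'"
      using x by (simp add: if_distrib[of "\<lambda>c. c * _"] if_distrib[of "\<lambda>c. _ * c"] cong: if_cong)
    finally show "f x x' = (\<Sum>y'\<in>set ys. (\<Sum>y\<in>set ys. (if x = h y then 1 else 0) * f (h y) (h y'))
        * (if x' = h y' then 1 else 0))" by simp
  qed (use assms in auto)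
qed

section \<open>Block triangular matrices and Kronecker sums\<close>

lemma char_poly_idx_mat_append:
  fixes f :: "'i \<Rightarrow> 'i \<Rightarrow> 'c::idom"
  assumes z: "\<And>x y. x \<in> set xs \<Longrightarrow> y \<in> set ys \<Longrightarrow> f y x = 0"
  shows "char_poly (idx_mat f (xs @ ys)) = char_poly (idx_mat f xs) * char_poly (idx_mat f ys)"
proof -
  let ?n = "length xs" and ?m = "length ys"
  let ?A2 = "mat ?n ?m (\<lambda>(i, j). [:- f (xs ! i) (ys ! j):])"
  have "char_poly_matrix (idx_mat f (xs @ ys)) =
      four_block_mat (char_poly_matrix (idx_mat f xs)) ?A2 (0\<^sub>m ?m ?n) (char_poly_matrix (idx_mat f ys))"
    by (rule eq_matI) (auto simp: char_poly_matrix_def idx_mat_def nth_append z not_less)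
  then show ?thesis
    unfolding char_poly_def
    by (simp add: det_four_block_mat_lower_left_zero[of _ ?n _ ?m])
qed

lemma char_poly_idx_mat_Nil [simp]: "char_poly (idx_mat f []) = 1"
  by (simp add: char_poly_def char_poly_matrix_def idx_mat_def)

text \<open>\<open>List.product\<close> lists all pairs with first component \<open>i\<close>
  contiguously, so each \<open>i\<close> owns one diagonal block. The sortedness condition makes
  every block below the diagonal vanish, and the blocks split off one at a time.\<close>

lemma char_poly_idx_mat_block_triangular:
  fixes f :: "'i \<times> 'j \<Rightarrow> 'i \<times> 'j \<Rightarrow> 'c::idom"
  assumes "sorted_wrt (\<lambda>i i'. \<forall>c \<in> set cs. \<forall>d \<in> set cs. f (i', d) (i, c) = 0) is"
  shows "char_poly (idx_mat f (List.product is cs))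
    = (\<Prod>i\<leftarrow>is. char_poly (idx_mat (\<lambda>c d. f (i, c) (i, d)) cs))"
  using assms
proof (induction "is")
  case (Cons i "is")
  then have "char_poly (idx_mat f (map (Pair i) cs @ List.product is cs))
      = char_poly (idx_mat f (map (Pair i) cs)) * char_poly (idx_mat f (List.product is cs))"
    by (intro char_poly_idx_mat_append) auto
  with Cons show ?case by (simp add: idx_mat_map)
qed simp

text \<open>A triangularization \<open>A = P T P\<inverse>\<close> makes the matrix similar, via \<open>P \<otimes> I\<close>, to the block
  triangular matrix \<open>I \<otimes> B + T \<otimes> C\<close>.\<close>

lemma char_poly_kronecker:
  fixes A :: "'c::conjugatable_ordered_field mat" and B C :: "'j \<Rightarrow> 'j \<Rightarrow> 'c"
  assumes A: "A \<in> carrier_mat n n" and es: "char_poly A = (\<Prod>e\<leftarrow>es. [:- e, 1:])"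
    and cs: "distinct cs"
  shows "char_poly (idx_mat (\<lambda>(i, c) (j, d). (if i = j then B c d else 0) + A $$ (i, j) * C c d)
      (List.product [0..<n] cs)) = (\<Prod>e\<leftarrow>es. char_poly (idx_mat (\<lambda>c d. B c d + e * C c d) cs))"
proof -
  \<comment> \<open>The decomposition places the prescribed eigenvalues \<open>es\<close>, in this
    order, on the diagonal of \<open>T\<close>.\<close>
  obtain T P Q where schur: "schur_decomposition A es = (T, P, Q)"
    by (cases "schur_decomposition A es") auto
  have wit: "similar_mat_wit A T P Q" and ut: "upper_triangular T" and diag: "diag_mat T = es"
    using schur_decomposition[OF A es schur] by auto
  have car: "P \<in> carrier_mat n n" "Q \<in> carrier_mat n n" "T \<in> carrier_mat n n"
    and PQ: "P * Q = 1\<^sub>m n" and APTQ: "A = P * T * Q"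
    using similar_mat_witD2[OF A wit] by auto
  let ?g = "\<lambda>X (i, c) (j, d). (if i = j then B c d else 0) + X $$ (i, j) * C c d"
  have PQ': "(\<Sum>k = 0..<n. P $$ (i, k) * Q $$ (k, j)) = (if i = j then 1 else 0)"
    if "i < n" "j < n" for i j
    using arg_cong[OF PQ, of "\<lambda>X. X $$ (i, j)"] that car by (simp add: scalar_prod_def)
  have A': "A $$ (i, j) = (\<Sum>l = 0..<n. (\<Sum>k = 0..<n. P $$ (i, k) * T $$ (k, l)) * Q $$ (l, j))"
    if "i < n" "j < n" for i j
    using arg_cong[OF APTQ, of "\<lambda>X. X $$ (i, j)"] that car by (simp add: scalar_prod_def del: assoc_mult_mat)
  \<comment> \<open>Keeps the two parts of an entry apart: the \<open>B\<close> part collapses by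
    \<open>P * Q = 1\<close>, the \<open>C\<close> part reassembles
    \<open>A = P * T * Q\<close>.\<close>
  have split: "(\<Sum>l = 0..<n. (p l * b + u l * c) * q l)
      = (\<Sum>l = 0..<n. p l * q l) * b + (\<Sum>l = 0..<n. u l * q l) * c" for p u q :: "nat \<Rightarrow> 'c" and b c
    by (simp add: sum.distrib algebra_simps) (simp add: sum_distrib_left)
  have "similar_mat (idx_mat (?g A) (List.product [0..<n] cs)) (idx_mat (?g T) (List.product [0..<n] cs))"
  proof (rule similar_idx_mat[where p = "\<lambda>(i, c) (j, d). if c = d then P $$ (i, j) else 0"
        and q = "\<lambda>(i, c) (j, d). if c = d then Q $$ (i, j) else 0"])
    fix x x' assume x: "x \<in> set (List.product [0..<n] cs)" "x' \<in> set (List.product [0..<n] cs)"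
    obtain i c i' c' where xs: "x = (i, c)" "x' = (i', c')" by (cases x, cases x')
    with x have i: "i < n" "i' < n" "c \<in> set cs" "c' \<in> set cs" by auto
    show "(\<Sum>y\<in>set (List.product [0..<n] cs).
        (case x of (i, c) \<Rightarrow> \<lambda>(j, d). if c = d then P $$ (i, j) else 0) y *
        (case y of (i, c) \<Rightarrow> \<lambda>(j, d). if c = d then Q $$ (i, j) else 0) x') = (if x = x' then 1 else 0)"
      using i by (cases "c = c'") (simp_all add: xs sum.cartesian_product' PQ'
          if_distrib[of "\<lambda>c. c * _"] cong: if_cong)
    \<comment> \<open>An entry of \<open>P \<otimes> I\<close> times
      \<open>I \<otimes> B + T \<otimes> C\<close>, which is
      \<open>P \<otimes> B + (P * T) \<otimes> C\<close>.\<close>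
    have "(\<Sum>y\<in>set (List.product [0..<n] cs).
        (case x of (i, c) \<Rightarrow> \<lambda>(j, d). if c = d then P $$ (i, j) else 0) y * ?g T y (l, d))
      = P $$ (i, l) * B c d + (\<Sum>k = 0..<n. P $$ (i, k) * T $$ (k, l)) * C c d" if "l < n" for l d
    proof -
      have "(\<Sum>y\<in>set (List.product [0..<n] cs).
          (case x of (i, c) \<Rightarrow> \<lambda>(j, d). if c = d then P $$ (i, j) else 0) y * ?g T y (l, d))
        = (\<Sum>k = 0..<n. P $$ (i, k) * ((if k = l then B c d else 0) + T $$ (k, l) * C c d))"
        using i by (simp add: xs sum.cartesian_product' if_distrib[of "\<lambda>c. c * _"] cong: if_cong)
      also have "\<dots> = P $$ (i, l) * B c d + (\<Sum>k = 0..<n. P $$ (i, k) * T $$ (k, l)) * C c d"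
        using that by (simp add: sum.distrib sum_distrib_right distrib_left mult.assoc
            if_distrib[of "\<lambda>c. _ * c"] cong: if_cong)
      finally show ?thesis .
    qed
    then have "(\<Sum>y'\<in>set (List.product [0..<n] cs). (\<Sum>y\<in>set (List.product [0..<n] cs).
        (case x of (i, c) \<Rightarrow> \<lambda>(j, d). if c = d then P $$ (i, j) else 0) y * ?g T y y') *
        (case y' of (i, c) \<Rightarrow> \<lambda>(j, d). if c = d then Q $$ (i, j) else 0) x')
      = (\<Sum>l = 0..<n. (P $$ (i, l) * B c c' + (\<Sum>k = 0..<n. P $$ (i, k) * T $$ (k, l)) * C c c') * Q $$ (l, i'))"
      using i by (simp add: xs sum.cartesian_product' if_distrib[of "\<lambda>c. _ * c"] cong: if_cong)
    also have "\<dots> = (\<Sum>l = 0..<n. P $$ (i, l) * Q $$ (l, i')) * B c c'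
        + (\<Sum>l = 0..<n. (\<Sum>k = 0..<n. P $$ (i, k) * T $$ (k, l)) * Q $$ (l, i')) * C c c'"
      by (rule split)
    also have "\<dots> = ?g A x x'"
      using i by (simp add: xs PQ' A')
    finally show "?g A x x' = (\<Sum>y'\<in>set (List.product [0..<n] cs). (\<Sum>y\<in>set (List.product [0..<n] cs).
        (case x of (i, c) \<Rightarrow> \<lambda>(j, d). if c = d then P $$ (i, j) else 0) y * ?g T y y') *
        (case y' of (i, c) \<Rightarrow> \<lambda>(j, d). if c = d then Q $$ (i, j) else 0) x')" by (rule sym)
  qed (simp_all add: distinct_product cs)
  then have "char_poly (idx_mat (?g A) (List.product [0..<n] cs))
      = char_poly (idx_mat (?g T) (List.product [0..<n] cs))"
    by (rule char_poly_similar)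
  also have "\<dots> = (\<Prod>i\<leftarrow>[0..<n]. char_poly (idx_mat (\<lambda>c d. ?g T (i, c) (i, d)) cs))"
  proof (rule char_poly_idx_mat_block_triangular)
    show "sorted_wrt (\<lambda>i i'. \<forall>c \<in> set cs. \<forall>d \<in> set cs. ?g T (i', d) (i, c) = 0) [0..<n]"
      using ut car by (auto simp: sorted_wrt_iff_nth_less upper_triangularD)
  qed
  also have "\<dots> = (\<Prod>e\<leftarrow>diag_mat T. char_poly (idx_mat (\<lambda>c d. B c d + e * C c d) cs))"
    using car by (simp add: diag_mat_def comp_def)
  finally show ?thesis by (simp add: diag)
qed

subsection \<open>Bordered matrices\<close>

text \<open>Substituting \<open>X - c\<close> for \<open>X\<close> is a ring homomorphism on
  polynomials, so it commutes with the determinant and can be checked entrywise on the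
  characteristic matrix.\<close>

lemma char_poly_add_scalar:
  fixes A :: "'c::comm_ring_1 mat"
  assumes A: "A \<in> carrier_mat n n"
  shows "char_poly (A + c \<cdot>\<^sub>m 1\<^sub>m n) = char_poly A \<circ>\<^sub>p [:- c, 1:]"
proof -
  have "char_poly_matrix (A + c \<cdot>\<^sub>m 1\<^sub>m n) = map_mat (\<lambda>p. p \<circ>\<^sub>p [:- c, 1:]) (char_poly_matrix A)"
    using A by (intro eq_matI) (auto simp: char_poly_matrix_def pcompose_add pcompose_pCons)
  then show ?thesis
    by (simp add: char_poly_def comm_ring_hom.hom_det[OF pcompose_hom.comm_ring_hom_axioms])
qed

text \<open>Multiplying the characteristic matrix \<open>K\<close> on the right by
  \<open>[[X - s, 0], [b 1, I]]\<close> clears its lower left block.\<close>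

lemma char_poly_bordered:
  fixes F :: "'c::idom mat"
  assumes F: "F \<in> carrier_mat n n"
    and rows: "\<And>i. i < n \<Longrightarrow> (\<Sum>j = 0..<n. F $$ (i, j)) = s"
  shows "char_poly (four_block_mat (mat 1 1 (\<lambda>_. a)) (mat 1 n (\<lambda>_. b)) (mat n 1 (\<lambda>_. b)) F) * [:- s, 1:]
    = ([:- a, 1:] * [:- s, 1:] - [:of_nat n * b\<^sup>2:]) * char_poly F"
proof -
  let ?M = "four_block_mat (mat 1 1 (\<lambda>_. a)) (mat 1 n (\<lambda>_. b)) (mat n 1 (\<lambda>_. b)) F"
  let ?K = "four_block_mat (mat 1 1 (\<lambda>_. [:- a, 1:])) (mat 1 n (\<lambda>_. [:- b:]))
    (mat n 1 (\<lambda>_. [:- b:])) (char_poly_matrix F)"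
  let ?E = "four_block_mat (mat 1 1 (\<lambda>_. [:- s, 1:])) (0\<^sub>m 1 n) (mat n 1 (\<lambda>_. [:b:])) (1\<^sub>m n)"
  let ?p = "[:- a, 1:] * [:- s, 1:] - [:of_nat n * b\<^sup>2:]"
  have K: "char_poly_matrix ?M = ?K"
    using F by (intro eq_matI) (auto simp: char_poly_matrix_def)
  have cF: "char_poly_matrix F \<in> carrier_mat n n" using F by simp
  \<comment> \<open>This is why the column operation works: the characteristic matrix of
    \<open>F\<close> sends \<open>b 1\<close> to \<open>b (X - s) 1\<close>, which cancels the
    border \<open>- b 1\<close> scaled by \<open>X - s\<close>.\<close>
  have row: "(\<Sum>j = 0..<n. char_poly_matrix F $$ (i, j)) = [:- s, 1:]" if "i < n" for i
  proof -
    have "(\<Sum>j = 0..<n. char_poly_matrix F $$ (i, j))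
        = (\<Sum>j = 0..<n. (if j = i then [:0, 1:] else 0) - [:F $$ (i, j):])"
      using F that by (intro sum.cong) (auto simp: char_poly_matrix_def)
    also have "\<dots> = [:0, 1:] - (\<Sum>j = 0..<n. [:F $$ (i, j):])"
      using that by (simp add: sum_subtractf)
    also have "(\<Sum>j = 0..<n. [:F $$ (i, j):]) = [:\<Sum>j = 0..<n. F $$ (i, j):]"
      by (rule poly_eqI) (simp add: coeff_sum coeff_pCons split: nat.split)
    finally show ?thesis using rows[OF that] by simp
  qed
  have "?K * ?E = four_block_mat (mat 1 1 (\<lambda>_. ?p)) (mat 1 n (\<lambda>_. [:- b:])) (0\<^sub>m n 1) (char_poly_matrix F)"
  proof (subst mult_four_block_mat[of _ 1 1 _ n _ n _ _ 1 _ n], goal_cases)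
    \<comment> \<open>Goal 9 is the identity of blocks; the remaining goals are the dimension
      conditions of the block product.\<close>
    case 9
    have "mat n 1 (\<lambda>_. [:- b:]) * mat 1 1 (\<lambda>_. [:- s, 1:]) + char_poly_matrix F * mat n 1 (\<lambda>_. [:b:]) = 0\<^sub>m n 1"
    proof (rule eq_matI, goal_cases)
      case (1 i j)
      then have "(char_poly_matrix F * mat n 1 (\<lambda>_. [:b:])) $$ (i, j)
          = (\<Sum>j = 0..<n. char_poly_matrix F $$ (i, j)) * [:b:]"
        using cF by (simp add: scalar_prod_def smult_sum2)
      with 1 row cF show ?case by (simp add: scalar_prod_def)
    qed (use cF in auto)
    moreover have "mat 1 1 (\<lambda>_. [:- a, 1:]) * mat 1 1 (\<lambda>_. [:- s, 1:]) + mat 1 n (\<lambda>_. [:- b:]) * mat n 1 (\<lambda>_. [:b:])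
        = mat 1 1 (\<lambda>_. ?p)"
      by (rule eq_matI) (auto simp: scalar_prod_def power2_eq_square of_nat_poly algebra_simps)
    moreover have "mat 1 1 (\<lambda>_. [:- a, 1:]) * 0\<^sub>m 1 n + mat 1 n (\<lambda>_. [:- b:]) * 1\<^sub>m n = mat 1 n (\<lambda>_. [:- b:])"
      by (subst right_mult_one_mat[of _ 1]) auto
    moreover have "mat n 1 (\<lambda>_. [:- b:]) * 0\<^sub>m 1 n + char_poly_matrix F * 1\<^sub>m n = char_poly_matrix F"
      using cF by (subst right_mult_zero_mat[of _ n 1]) auto
    ultimately show ?case by simp
  qed (use cF in auto)
  then have "det (?K * ?E) = ?p * char_poly F"
    using cF by (simp add: det_four_block_mat_lower_left_zero[of _ 1 _ n] char_poly_def det_single)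
  moreover have "det (?K * ?E) = det ?K * det ?E"
    using cF by (intro det_mult[of _ "1 + n"]) auto
  moreover have "det ?E = [:- s, 1:]"
    by (subst det_four_block_mat_upper_right_zero[of _ 1 _ n]) (auto simp: det_single)
  ultimately have "det ?K * [:- s, 1:] = ?p * char_poly F" by (simp only:)
  then show ?thesis unfolding char_poly_def[of ?M] K .
qed

subsection \<open>Net Laplacians and the s-neighbourhood corona\<close>

definition signed_adj :: "'v sgraph \<Rightarrow> 'v \<Rightarrow> 'v \<Rightarrow> real" where
  "signed_adj S u v = (if {u, v} \<in> edges S then real_of_int (edge_sign S {u, v}) else 0)"

lemma signed_adj_commute: "signed_adj S u v = signed_adj S v u"
  by (simp add: signed_adj_def insert_commute)

context signed_graph
begin

text \<open>An edge at \<open>v\<close> is determined by its other endpoint. This turns counts of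
  edges into counts of vertices, and so the net-degree into a row sum of the adjacency
  matrix.\<close>

lemma card_incident_edges:
  assumes "v \<in> verts S"
  shows "card {e \<in> edges S. v \<in> e \<and> P e} = card {u \<in> verts S. {v, u} \<in> edges S \<and> P {v, u}}"
proof -
  have "bij_betw (\<lambda>u. {v, u}) {u \<in> verts S. {v, u} \<in> edges S \<and> P {v, u}} {e \<in> edges S. v \<in> e \<and> P e}"
  proof (rule bij_betw_imageI)
    show "inj_on (\<lambda>u. {v, u}) {u \<in> verts S. {v, u} \<in> edges S \<and> P {v, u}}"
      by (auto simp: inj_on_def doubleton_eq_iff)
    have "\<exists>u \<in> verts S. e = {v, u}" if "e \<in> edges S" "v \<in> e" for e
      using simple_edges that by (fastforce simp: insert_commute)
    then show "(\<lambda>u. {v, u}) ` {u \<in> verts S. {v, u} \<in> edges S \<and> P {v, u}} = {e \<in> edges S. v \<in> e \<and> P e}"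
      by auto
  qed
  from bij_betw_same_card[OF this] show ?thesis by (rule sym)
qed

lemma net_degree_eq_sum:
  assumes "v \<in> verts S"
  shows "real_of_int (net_degree S v) = (\<Sum>u\<in>verts S. signed_adj S v u)"
proof -
  \<comment> \<open>The sign is the difference of the indicators of a positive and a negative
    edge.\<close>
  have "signed_adj S v u = (if {v, u} \<in> edges S \<and> edge_sign S {v, u} = 1 then 1 else 0)
      - (if {v, u} \<in> edges S \<and> edge_sign S {v, u} = -1 then 1 else 0)" for u
    using sign_values[of "{v, u}"] by (auto simp: signed_adj_def)
  then have "(\<Sum>u\<in>verts S. signed_adj S v u)
      = real (card {u \<in> verts S. {v, u} \<in> edges S \<and> edge_sign S {v, u} = 1})
      - real (card {u \<in> verts S. {v, u} \<in> edges S \<and> edge_sign S {v, u} = -1})"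
    using finite_verts by (simp add: sum_subtractf sum.If_cases Int_def)
  with assms show ?thesis
    by (simp add: net_degree_def card_incident_edges)
qed

end

text \<open>The degree is written as a row sum, so that in the corona it splits along the vertex set
  and no edges have to be counted there.\<close>

definition laplacian_entry :: "'v sgraph \<Rightarrow> 'v \<Rightarrow> 'v \<Rightarrow> real" where
  "laplacian_entry S u v = (if u = v then (\<Sum>w\<in>verts S. signed_adj S u w) else 0) - signed_adj S u v"

lemma net_laplacian_eq_idx_mat:
  assumes "signed_graph S" and "enumerates_verts vs S"
  shows "net_laplacian S vs = idx_mat (laplacian_entry S) vs"
proof -
  interpret signed_graph S by fact
  have vs: "distinct vs" "set vs = verts S" using assms(2) by (simp_all add: enumerates_verts_def)
  have "vs ! i \<in> verts S" if "i < length vs" for i using vs that by (metis nth_mem)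
  then show ?thesis
    using vs(1) by (intro eq_matI)
      (auto simp: net_laplacian_def net_degree_matrix_def adjacency_matrix_def idx_mat_def
        laplacian_entry_def net_degree_eq_sum nth_eq_iff_index_eq signed_adj_def)
qed

text \<open>The all-ones vector lies in the kernel. After the shift by \<open>r\<close> this yields
  the constant row sums that \<open>char_poly_bordered\<close> asks for.\<close>

lemma (in signed_graph) sum_laplacian_entry:
  assumes "u \<in> verts S"
  shows "(\<Sum>v\<in>verts S. laplacian_entry S u v) = 0"
  using assms finite_verts by (simp add: laplacian_entry_def sum_subtractf)

section \<open>Adjacency and Laplacian entries of the corona\<close>

lemma s_nbhd_corona_edges:
  "{Inl u, Inl v} \<in> edges (S1 \<star>\<^sub>s S2) \<longleftrightarrow> {u, v} \<in> edges S1"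
  "{Inl h, Inr (v, w)} \<in> edges (S1 \<star>\<^sub>s S2) \<longleftrightarrow> {h, v} \<in> edges S1 \<and> w \<in> verts S2"
  "{Inr (v, w), Inr (v', x)} \<in> edges (S1 \<star>\<^sub>s S2) \<longleftrightarrow> v = v' \<and> v \<in> verts S1 \<and> {w, x} \<in> edges S2"
  by (auto simp: s_nbhd_corona_def doubleton_eq_iff insert_commute)

lemma signed_adj_s_nbhd_corona:
  "signed_adj (S1 \<star>\<^sub>s S2) (Inl u) (Inl v) = signed_adj S1 u v"
  "signed_adj (S1 \<star>\<^sub>s S2) (Inl h) (Inr (v, w)) = (if w \<in> verts S2 then signed_adj S1 h v else 0)"
  "signed_adj (S1 \<star>\<^sub>s S2) (Inr (v, w)) (Inl h) = (if w \<in> verts S2 then signed_adj S1 v h else 0)"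
  "signed_adj (S1 \<star>\<^sub>s S2) (Inr (v, w)) (Inr (v', x))
    = (if v = v' \<and> v \<in> verts S1 then signed_adj S2 w x else 0)"
proof -
  show inlr: "signed_adj (S1 \<star>\<^sub>s S2) (Inl h) (Inr (v, w)) = (if w \<in> verts S2 then signed_adj S1 h v else 0)" for h v w
    by (simp add: signed_adj_def s_nbhd_corona_edges)
  show "signed_adj (S1 \<star>\<^sub>s S2) (Inr (v, w)) (Inl h) = (if w \<in> verts S2 then signed_adj S1 v h else 0)"
    by (subst (1 2) signed_adj_commute) (rule inlr)
qed (auto simp: signed_adj_def s_nbhd_corona_edges)

lemma sum_verts_s_nbhd_corona:
  assumes "signed_graph S1" and "signed_graph S2"
  shows "(\<Sum>x\<in>verts (S1 \<star>\<^sub>s S2). f x)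
    = (\<Sum>v\<in>verts S1. f (Inl v)) + (\<Sum>v\<in>verts S1. \<Sum>w\<in>verts S2. f (Inr (v, w)))"
proof -
  have fin: "finite (verts S1)" "finite (verts S2)"
    using assms by (auto dest: signed_graph.finite_verts)
  have "(\<Sum>x\<in>verts (S1 \<star>\<^sub>s S2). f x) = sum f (Inl ` verts S1) + sum f (Inr ` (verts S1 \<times> verts S2))"
    using fin by (simp add: s_nbhd_corona_def) (rule sum.union_disjoint, auto)
  then show ?thesis
    by (simp add: sum.reindex sum.cartesian_product')
qed

text \<open>Net regularity makes minus the adjacency of \<open>S1\<close> equal to
  \<open>N - r I\<close>, with \<open>N\<close> its net Laplacian. A vertex of \<open>S1\<close> has
  net-degree \<open>r\<close> within \<open>S1\<close> and \<open>n2 * r\<close> towards the copies;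
  a vertex of a copy gains \<open>r\<close> over its net-degree in \<open>S2\<close>.\<close>

lemma laplacian_entry_s_nbhd_corona:
  assumes "signed_graph S1" and "signed_graph S2"
    and deg: "\<And>v. v \<in> verts S1 \<Longrightarrow> (\<Sum>u\<in>verts S1. signed_adj S1 v u) = r"
    and "u \<in> verts S1" "v \<in> verts S1"
  shows "laplacian_entry (S1 \<star>\<^sub>s S2) (Inl u) (Inl v)
      = (if u = v then real (card (verts S2)) * r else 0) + laplacian_entry S1 u v"
    and "w \<in> verts S2 \<Longrightarrow> laplacian_entry (S1 \<star>\<^sub>s S2) (Inl u) (Inr (v, w))
      = (if u = v then - r else 0) + laplacian_entry S1 u v"
    and "w \<in> verts S2 \<Longrightarrow> laplacian_entry (S1 \<star>\<^sub>s S2) (Inr (u, w)) (Inl v)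
      = (if u = v then - r else 0) + laplacian_entry S1 u v"
    and "w \<in> verts S2 \<Longrightarrow> x \<in> verts S2 \<Longrightarrow> laplacian_entry (S1 \<star>\<^sub>s S2) (Inr (u, w)) (Inr (v, x))
      = (if u = v then laplacian_entry S2 w x + (if w = x then r else 0) else 0)"
proof -
  have fin: "finite (verts S1)" "finite (verts S2)"
    using assms by (auto dest: signed_graph.finite_verts)
  note defs = laplacian_entry_def signed_adj_s_nbhd_corona sum_verts_s_nbhd_corona[OF assms(1,2)] deg assms
  show "laplacian_entry (S1 \<star>\<^sub>s S2) (Inl u) (Inl v)
      = (if u = v then real (card (verts S2)) * r else 0) + laplacian_entry S1 u v"
    by (simp add: defs sum_distrib_left[symmetric])
  show "laplacian_entry (S1 \<star>\<^sub>s S2) (Inl u) (Inr (v, w))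
      = (if u = v then - r else 0) + laplacian_entry S1 u v" if "w \<in> verts S2"
    using that by (simp add: defs)
  show "laplacian_entry (S1 \<star>\<^sub>s S2) (Inr (u, w)) (Inl v)
      = (if u = v then - r else 0) + laplacian_entry S1 u v" if "w \<in> verts S2"
    using that by (simp add: defs)
  \<comment> \<open>Within the copies, a vertex has neighbours only in its own copy.\<close>
  have row: "(\<Sum>v'\<in>verts S1. \<Sum>x\<in>verts S2. if u = v' then signed_adj S2 w x else 0)
      = (\<Sum>x\<in>verts S2. signed_adj S2 w x)" if "u \<in> verts S1" for u w
    using fin that by (subst sum.swap) simp
  show "laplacian_entry (S1 \<star>\<^sub>s S2) (Inr (u, w)) (Inr (v, x))
      = (if u = v then laplacian_entry S2 w x + (if w = x then r else 0) else 0)"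
    if "w \<in> verts S2" "x \<in> verts S2"
    using that by (simp add: defs row)
qed

section \<open>Recovering polynomials from their roots\<close>

text \<open>Dividing by \<open>X - x\<close> for a root \<open>x\<close> lowers the degree and the
  number of roots by one each, so their equality persists until the constant 1 is reached.\<close>

lemma split_poly_eq_prod_proots:
  fixes p :: "'c::idom poly"
  assumes "lead_coeff p = 1" and "size (proots p) = degree p"
  shows "p = (\<Prod>x\<in>#proots p. [:- x, 1:])"
  using assms
proof (induction "degree p" arbitrary: p)
  case 0
  then obtain c where "p = [:c:]" by (metis degree_eq_zeroE)
  with 0 show ?case by (simp add: one_pCons)
next
  case (Suc n)
  then have "proots p \<noteq> {#}" by auto
  then obtain x where "x \<in># proots p" by blast
  moreover have p0: "p \<noteq> 0" using Suc by auto
  ultimately have "poly p x = 0" by (simp add: set_count_proots)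
  then obtain q where q: "p = [:- x, 1:] * q" by (metis dvdE poly_eq_0_iff_dvd)
  with p0 have q0: "q \<noteq> 0" by auto
  have prp: "proots p = add_mset x (proots q)"
    using p0 unfolding q by (subst proots_mult) auto
  have "degree p = Suc (degree q)" unfolding q using q0 by (subst degree_mult_eq) auto
  moreover have "lead_coeff q = 1" using Suc.prems unfolding q by (subst (asm) lead_coeff_mult) simp
  ultimately have "q = (\<Prod>x\<in>#proots q. [:- x, 1:])"
    using Suc prp by (intro Suc.hyps) auto
  with q prp show ?case by (metis image_mset_add_mset prod_mset.add_mset)
qed

text \<open>The given spectrum lists \<open>n\<close> real roots, as many as the degree, so the
  characteristic polynomial splits by counting.\<close>

lemma char_poly_of_spectrum:
  fixes f :: "nat \<Rightarrow> real"
  assumes A: "A \<in> carrier_mat n n" and spec: "spectrum_mset A = {# f i. i \<in># mset_set {1..n} #}"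
  shows "char_poly A = (\<Prod>i = 1..n. [:- f i, 1:])"
proof -
  have "lead_coeff (char_poly A) = 1" "degree (char_poly A) = n"
    using degree_monic_char_poly[OF A] by auto
  then have "char_poly A = (\<Prod>x\<in>#spectrum_mset A. [:- x, 1:])"
    using spec unfolding spectrum_mset_def by (intro split_poly_eq_prod_proots) simp_all
  then show ?thesis
    by (simp add: spec prod_unfold_prod_mset image_mset.compositionality comp_def)
qed

lemma monic_quadratic_factorization:
  fixes t d :: real
  assumes "t\<^sup>2 - 4 * d \<ge> 0"
  shows "[:d, - t, 1:] = [:- ((t + sqrt (t\<^sup>2 - 4 * d)) / 2), 1:] * [:- ((t - sqrt (t\<^sup>2 - 4 * d)) / 2), 1:]"
proof -
  define s where "s = sqrt (t\<^sup>2 - 4 * d)"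
  have "s\<^sup>2 = t\<^sup>2 - 4 * d" using assms by (simp add: s_def)
  then have "d = (t + s) / 2 * ((t - s) / 2)"
    by (simp add: field_simps power2_eq_square)
  moreover have "t = (t + s) / 2 + (t - s) / 2" by (simp add: field_simps)
  ultimately show ?thesis unfolding s_def[symmetric] by simp
qed

section \<open>The characteristic polynomial of the corona\<close>

text \<open>The matrices \<open>B\<close> and \<open>C\<close> of the decomposition \<open>I \<otimes> B + N \<otimes> C\<close>; the index \<open>None\<close> stands for the
  vertex of the first graph itself and \<open>Some w\<close> for the vertex \<open>w\<close> of its copy of the second graph.\<close>

definition corona_base :: "real \<Rightarrow> 'b sgraph \<Rightarrow> 'b option \<Rightarrow> 'b option \<Rightarrow> real" where
  "corona_base r S c d = (case (c, d) of
     (None, None) \<Rightarrow> real (card (verts S)) * r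
   | (Some w, Some x) \<Rightarrow> laplacian_entry S w x + (if w = x then r else 0)
   | _ \<Rightarrow> - r)"

definition corona_coupling :: "'b option \<Rightarrow> 'b option \<Rightarrow> real" where
  "corona_coupling c d = (if c = None \<or> d = None then 1 else 0)"

text \<open>This is the factor of the corona polynomial belonging to one eigenvalue \<open>e\<close>
  of \<open>S1\<close>. The bordered identity carries an extra factor \<open>X - r\<close>, which
  cancels against the one that the eigenvalue 0 of \<open>S2\<close> puts into the polynomial of
  \<open>?F\<close>.\<close>

lemma char_poly_corona_quotient:
  assumes S: "signed_graph S" and vs: "enumerates_verts vs S"
    and spec: "spectrum_mset (net_laplacian S vs) = {# f j. j \<in># mset_set {1..card (verts S)} #}"
    and k: "k \<in> {1..card (verts S)}" "f k = 0"
  defines "n \<equiv> real (card (verts S))"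
  shows "char_poly (idx_mat (\<lambda>c d. corona_base r S c d + e * corona_coupling c d) (None # map Some vs))
    = [:e * ((2 * n + 1) * r - n * e), - (e + (n + 1) * r), 1:]
      * (\<Prod>j\<in>{1..card (verts S)} - {k}. [:- (f j + r), 1:])" (is "?P = ?q * ?R")
proof -
  interpret signed_graph S by fact
  let ?m = "card (verts S)"
  have vs': "distinct vs" "set vs = verts S" "length vs = ?m"
    using vs by (auto simp: enumerates_verts_def dest: distinct_card)
  define N where "N = net_laplacian S vs"
  have N: "N = idx_mat (laplacian_entry S) vs"
    using S vs by (simp add: N_def net_laplacian_eq_idx_mat)
  have Nc: "N \<in> carrier_mat ?m ?m" by (simp add: N flip: vs'(3))
  let ?F = "N + r \<cdot>\<^sub>m 1\<^sub>m ?m"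
  have Fc: "?F \<in> carrier_mat ?m ?m" using Nc by simp
  have rows: "(\<Sum>j = 0..<?m. ?F $$ (i, j)) = r" if "i < ?m" for i
  proof -
    have "?F $$ (i, j) = laplacian_entry S (vs ! i) (vs ! j) + (if i = j then r else 0)" if "j < ?m" for j
      using Nc that \<open>i < ?m\<close> by (simp add: N idx_mat_def vs'(3))
    then have "(\<Sum>j = 0..<?m. ?F $$ (i, j)) = (\<Sum>j = 0..<length vs. laplacian_entry S (vs ! i) (vs ! j)) + r"
      using that by (simp add: vs'(3) sum.distrib)
    moreover have "vs ! i \<in> verts S" using that vs'(2,3) by (metis nth_mem)
    ultimately show ?thesis
      using sum_distinct_nth[OF vs'(1), of "laplacian_entry S (vs ! i)"]
      by (simp add: vs'(2) sum_laplacian_entry)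
  qed
  \<comment> \<open>The coupling adds \<open>e\<close> exactly in the row and column of
    \<open>None\<close>: the corner becomes \<open>n * r + e\<close>, the border
    \<open>e - r\<close>.\<close>
  have "idx_mat (\<lambda>c d. corona_base r S c d + e * corona_coupling c d) (None # map Some vs)
      = four_block_mat (mat 1 1 (\<lambda>_. n * r + e)) (mat 1 ?m (\<lambda>_. e - r)) (mat ?m 1 (\<lambda>_. e - r)) ?F"
    using vs'(1,3) by (intro eq_matI)
      (auto simp: idx_mat_def N corona_base_def corona_coupling_def n_def nth_Cons'
        nth_eq_iff_index_eq)
  then have "?P * [:- r, 1:] = ([:- (n * r + e), 1:] * [:- r, 1:] - [:n * (e - r)\<^sup>2:]) * char_poly ?F"
    using char_poly_bordered[OF Fc rows, of "n * r + e" "e - r"] by (simp only: n_def)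
  \<comment> \<open>In the constant term the two contributions \<open>n * r^2\<close> cancel, which
    leaves a multiple of \<open>e\<close>.\<close>
  also have "[:- (n * r + e), 1:] * [:- r, 1:] - [:n * (e - r)\<^sup>2:] = ?q"
    by (simp add: algebra_simps power2_eq_square)
  also have "char_poly ?F = (\<Prod>j = 1..?m. [:- (f j + r), 1:])"
    using Nc spec unfolding N_def[symmetric]
    by (simp add: char_poly_add_scalar char_poly_of_spectrum pcompose_prod pcompose_pCons)
  \<comment> \<open>The factor of index \<open>k\<close> is \<open>X - r\<close>, because
    \<open>f k = 0\<close>.\<close>
  also have "\<dots> = [:- r, 1:] * ?R"
    using k by (subst prod.remove[of _ k]) auto
  finally have "[:- r, 1:] * ?P = [:- r, 1:] * (?q * ?R)" by (simp only: mult_ac)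
  then show ?thesis by (subst (asm) mult_left_cancel) auto
qed

lemma char_poly_net_laplacian_s_nbhd_corona:
  fixes S1 :: "'a sgraph" and S2 :: "'b sgraph"
  assumes S1: "signed_graph S1" and S2: "signed_graph S2"
    and vs1: "enumerates_verts vs1 S1" and vs2: "enumerates_verts vs2 S2"
    and vs: "enumerates_verts vs (S1 \<star>\<^sub>s S2)"
    and reg: "net_regular S1 r"
    and es: "char_poly (net_laplacian S1 vs1) = (\<Prod>e\<leftarrow>es. [:- e, 1:])"
  shows "char_poly (net_laplacian (S1 \<star>\<^sub>s S2) vs) = (\<Prod>e\<leftarrow>es. char_poly
    (idx_mat (\<lambda>c d. corona_base (of_int r) S2 c d + e * corona_coupling c d) (None # map Some vs2)))"
proof -
  let ?cs = "None # map Some vs2" and ?n = "length vs1"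
  define A where "A = net_laplacian S1 vs1"
  \<comment> \<open>Groups each vertex of \<open>S1\<close> with its own copy of \<open>S2\<close>,
    so that block \<open>(i, j)\<close> of the relabelled matrix has the Kronecker form.\<close>
  define h where "h = (\<lambda>(i, c). case c of None \<Rightarrow> Inl (vs1 ! i) | Some w \<Rightarrow> Inr (vs1 ! i, w :: 'b))"
  have d1: "distinct vs1" "set vs1 = verts S1" and d2: "distinct vs2" "set vs2 = verts S2"
    and d: "distinct vs" "set vs = verts (S1 \<star>\<^sub>s S2)"
    using vs1 vs2 vs by (auto simp: enumerates_verts_def)
  have A: "A = idx_mat (laplacian_entry S1) vs1"
    using S1 vs1 by (simp add: A_def net_laplacian_eq_idx_mat)
  have cs: "distinct ?cs" "set ?cs = insert None (Some ` verts S2)"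
    using d2 by (auto simp: distinct_map)
  have nth1: "bij_betw (\<lambda>i. vs1 ! i) {0..<?n} (verts S1)"
    using d1 by (intro bij_betw_nth) (auto simp: atLeast0LessThan)
  have bij: "bij_betw h (set (List.product [0..<?n] ?cs)) (set vs)"
  proof (rule bij_betw_imageI)
    show "inj_on h (set (List.product [0..<?n] ?cs))"
      using nth1 by (auto simp: h_def bij_betw_def inj_on_def)
    have "verts S1 = (\<lambda>i. vs1 ! i) ` {0..<?n}" using nth1 by (simp add: bij_betw_def)
    then show "h ` set (List.product [0..<?n] ?cs) = set vs"
      unfolding d set_product cs
      by (force simp: h_def s_nbhd_corona_def image_iff)
  qed
  have deg: "(\<Sum>u\<in>verts S1. signed_adj S1 v u) = of_int r" if "v \<in> verts S1" for v
    using that reg by (simp add: net_regular_def flip: signed_graph.net_degree_eq_sum[OF S1])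
  have "net_laplacian (S1 \<star>\<^sub>s S2) vs = idx_mat (laplacian_entry (S1 \<star>\<^sub>s S2)) vs"
    using signed_graph_s_nbhd_corona[OF S1 S2] vs by (rule net_laplacian_eq_idx_mat)
  then have "char_poly (net_laplacian (S1 \<star>\<^sub>s S2) vs)
      = char_poly (idx_mat (\<lambda>x y. laplacian_entry (S1 \<star>\<^sub>s S2) (h x) (h y)) (List.product [0..<?n] ?cs))"
    using bij d cs by (simp add: char_poly_similar similar_idx_mat_reindex distinct_product)
  also have "idx_mat (\<lambda>x y. laplacian_entry (S1 \<star>\<^sub>s S2) (h x) (h y)) (List.product [0..<?n] ?cs)
      = idx_mat (\<lambda>(i, c) (j, d). (if i = j then corona_base (of_int r) S2 c d else 0)
          + A $$ (i, j) * corona_coupling c d) (List.product [0..<?n] ?cs)"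
  proof (rule idx_mat_cong)
    fix x y assume xy: "x \<in> set (List.product [0..<?n] ?cs)" "y \<in> set (List.product [0..<?n] ?cs)"
    obtain i c j d where x: "x = (i, c)" and y: "y = (j, d)" by (cases x, cases y)
    have i: "i < ?n" "j < ?n" and c: "c \<in> insert None (Some ` verts S2)" "d \<in> insert None (Some ` verts S2)"
      using xy unfolding x y set_product cs by auto
    have v: "vs1 ! i \<in> verts S1" "vs1 ! j \<in> verts S1" using i d1 nth_mem by blast+
    have ij: "vs1 ! i = vs1 ! j \<longleftrightarrow> i = j" using i d1(1) by (simp add: nth_eq_iff_index_eq)
    have Aij: "A $$ (i, j) = laplacian_entry S1 (vs1 ! i) (vs1 ! j)" using i by (simp add: A idx_mat_def)
    have "laplacian_entry (S1 \<star>\<^sub>s S2) (h (i, c)) (h (j, d))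
        = (if i = j then corona_base (of_int r) S2 c d else 0) + A $$ (i, j) * corona_coupling c d"
      using c laplacian_entry_s_nbhd_corona[where r = "of_int r", OF S1 S2 deg v]
      by (cases c; cases d) (auto simp: h_def ij Aij corona_base_def corona_coupling_def)
    then show "laplacian_entry (S1 \<star>\<^sub>s S2) (h x) (h y)
        = (case x of (i, c) \<Rightarrow> \<lambda>(j, d). (if i = j then corona_base (of_int r) S2 c d else 0)
            + A $$ (i, j) * corona_coupling c d) y"
      by (simp add: x y)
  qed
  also have "char_poly \<dots> = (\<Prod>e\<leftarrow>es. char_poly
      (idx_mat (\<lambda>c d. corona_base (of_int r) S2 c d + e * corona_coupling c d) ?cs))"
    using es cs by (intro char_poly_kronecker) (simp_all add: A flip: A_def)
  finally show ?thesis .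
qed

section \<open>The spectrum of the corona\<close>

theorem theorem4p2:
  fixes S1 :: "'a sgraph" and S2 :: "'b sgraph"
    and vs1 :: "'a list" and vs2 :: "'b list" and vs :: "('a + 'a \<times> 'b) list"
    and n1 n2 k :: nat and r2 :: int
    and v1 v2 :: "nat \<Rightarrow> real"
  assumes "signed_graph S1" and "signed_graph S2"
    and "enumerates_verts vs1 S1" and "enumerates_verts vs2 S2"
    and "enumerates_verts vs (S1 \<star>\<^sub>s S2)"
    and "card (verts S1) = n1" and "card (verts S2) = n2"
    and "net_regular S1 r2"
    and "spectrum_mset (net_laplacian S1 vs1) = {# v1 i. i \<in># mset_set {1..n1} #}"
    and "spectrum_mset (net_laplacian S2 vs2) = {# v2 j. j \<in># mset_set {1..n2} #}"
    and "k \<in> {1..n2}" and "v2 k = 0"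
  shows "spectrum_mset (net_laplacian (S1 \<star>\<^sub>s S2) vs) =
      (\<Sum>j \<in> {1..n2} - {k}. replicate_mset n1 (v2 j + of_int r2))
    + (\<Sum>i \<in> {1..n1}.
         {# (v1 i + (real n2 + 1) * of_int r2
             + sqrt ((v1 i + (real n2 + 1) * of_int r2)^2
                 - 4 * v1 i * ((2 * real n2 + 1) * of_int r2 - real n2 * v1 i))) / 2,
            (v1 i + (real n2 + 1) * of_int r2
             - sqrt ((v1 i + (real n2 + 1) * of_int r2)^2
                 - 4 * v1 i * ((2 * real n2 + 1) * of_int r2 - real n2 * v1 i))) / 2 #})"
proof -
  define r where "r = real_of_int r2"
  define n where "n = real n2"
  define t where "t = (\<lambda>i. v1 i + (n + 1) * r)"
  define \<delta> where "\<delta> = (\<lambda>i. v1 i * ((2 * n + 1) * r - n * v1 i))"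
  define R where "R = (\<Prod>j\<in>{1..n2} - {k}. [:- (v2 j + r), 1:])"
  have "length vs1 = n1"
    using assms(3,6) by (auto simp: enumerates_verts_def dest: distinct_card)
  then have N1: "net_laplacian S1 vs1 \<in> carrier_mat n1 n1"
    using idx_mat_carrier[of "laplacian_entry S1" vs1] assms(1,3) by (simp add: net_laplacian_eq_idx_mat)
  have prod_v1: "(\<Prod>e\<leftarrow>map v1 [1..<Suc n1]. f e) = (\<Prod>i = 1..n1. f (v1 i))" for f :: "real \<Rightarrow> real poly"
    using prod.distinct_set_conv_list[of "[1..<Suc n1]" "\<lambda>i. f (v1 i)"]
    by (simp add: comp_def atLeastLessThanSuc_atLeastAtMost del: upt_Suc)
  have es: "char_poly (net_laplacian S1 vs1) = (\<Prod>e\<leftarrow>map v1 [1..<Suc n1]. [:- e, 1:])"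
    unfolding prod_v1 by (rule char_poly_of_spectrum[OF N1 assms(9)])
  have disc: "(t i)\<^sup>2 - 4 * \<delta> i \<ge> 0" for i
  proof -
    \<comment> \<open>The quadratic is the characteristic polynomial of a symmetric 2 by 2 matrix
      with diagonal \<open>n * r + v1 i\<close>, \<open>r\<close> and off-diagonal entry
      \<open>sqrt n * (v1 i - r)\<close>. Its discriminant is the squared difference of the diagonal
      entries plus four times the squared off-diagonal entry.\<close>
    have "(t i)\<^sup>2 - 4 * \<delta> i = (v1 i + (n - 1) * r)\<^sup>2 + 4 * n * (r - v1 i)\<^sup>2"
      by (simp add: t_def \<delta>_def power2_eq_square algebra_simps)
    then show ?thesis by (simp add: n_def)
  qed
  let ?pm = "\<lambda>i. {# (t i + sqrt ((t i)\<^sup>2 - 4 * \<delta> i)) / 2, (t i - sqrt ((t i)\<^sup>2 - 4 * \<delta> i)) / 2 #}"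
  have quad: "proots [:\<delta> i, - t i, 1:] = ?pm i" for i
    unfolding monic_quadratic_factorization[OF disc] by (subst proots_mult) auto
  have R: "R \<noteq> 0" "proots R = (\<Sum>j\<in>{1..n2} - {k}. {#v2 j + r#})"
    by (simp_all add: R_def proots_prod del: minus_add_distrib)
  \<comment> \<open>The factor \<open>R\<close> does not depend on the eigenvalue \<open>e\<close>,
    so it occurs \<open>n1\<close> times; this is the source of the multiplicity in (i).\<close>
  have "char_poly (net_laplacian (S1 \<star>\<^sub>s S2) vs) = (\<Prod>e\<leftarrow>map v1 [1..<Suc n1].
      [:e * ((2 * n + 1) * r - n * e), - (e + (n + 1) * r), 1:] * R)"
    unfolding char_poly_net_laplacian_s_nbhd_corona[OF assms(1-5,8) es]
    using char_poly_corona_quotient[OF assms(2,4), of v2 k r] assms(7,10-12)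
    by (simp add: r_def n_def R_def)
  also have "\<dots> = (\<Prod>i = 1..n1. [:\<delta> i, - t i, 1:] * R)"
    unfolding prod_v1 by (simp only: t_def \<delta>_def)
  finally have "spectrum_mset (net_laplacian (S1 \<star>\<^sub>s S2) vs) = proots (\<Prod>i = 1..n1. [:\<delta> i, - t i, 1:] * R)"
    by (simp only: spectrum_mset_def)
  also have "\<dots> = (\<Sum>i = 1..n1. proots ([:\<delta> i, - t i, 1:] * R))"
    by (rule proots_prod) (use R(1) in \<open>simp only: mult_eq_0_iff, simp\<close>)
  also have "\<dots> = (\<Sum>i = 1..n1. ?pm i + proots R)"
    using R(1) by (subst proots_mult) (simp_all only: quad, simp_all)
  also have "\<dots> = (\<Sum>i = 1..n1. \<Sum>j\<in>{1..n2} - {k}. {#v2 j + r#}) + (\<Sum>i = 1..n1. ?pm i)"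
    unfolding R(2) sum.distrib by (rule add.commute)
  also have "(\<Sum>i = 1..n1. \<Sum>j\<in>{1..n2} - {k}. {#v2 j + r#}) = (\<Sum>j\<in>{1..n2} - {k}. replicate_mset n1 (v2 j + r))"
  proof (subst sum.swap, rule sum.cong[OF refl])
    show "(\<Sum>i = 1..n1. {#x#}) = replicate_mset n1 x" for x :: real
      by (induction n1) auto
  qed
  finally show ?thesis
    unfolding t_def \<delta>_def r_def n_def by (simp only: mult.assoc)
qed

end
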